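(* If $M'$ is obtained from the rank-$r$ matroid $M$ on an $n$-element set by relaxing a circuit-hyperplane, then $$\mathcal{G}(M')-\mathcal{G}(M)=r!\,(n-r)!\,\bigl([1^r0^{n-r}]-[1^{r-1}010^{n-r-1}]\bigr).$$ Equivalently, the only compositions for which $\nu(M;\cdot)$ and $\nu(M';\cdot)$ differ are the following: $$\nu(M';0,1,\ldots,1,n-r+1)=\nu(M;0,1,\ldots,1,n-r+1)+r!$$ and $$\nu(M';0,1,\ldots,1,2,n-r)=\nu(M;0,1,\ldots,1,2,n-r)-\frac{r!}{2}.$$
   Context: If $X$ is both a circuit and a hyperplane (flat of rank $r(M)-1$) of a matroid $M$, the corresponding circuit-hyperplane relaxation is the matroid on the same set whose bases are those of $M$ together with $X$. $\mathcal{G}(n,r)$ is the vector space over a field of characteristic zero with basis the formal symbols $[\underline{r}]$, one for each $0,1$-sequence of length $n$ with exactly $r$ ones; $0^a$ and $1^b$ denote runs of $a$ zeros and $b$ ones. For a rank-$r$ matroid $M$ with rank function $r(\cdot)$ on an $n$-element set $E$ and a permutation (linear ordering) $\pi$ of $E$, the rank sequence $\underline{r}(\pi)=r_1\ldots r_n$ has $r_j=r(\{\pi(1),\ldots,\pi(j)\})-r(\{\pi(1),\ldots,\pi(j-1)\})$. The $\mathcal{G}$-invariant is $\mathcal{G}(M)=\sum_\pi[\underline{r}(\pi)]\in\mathcal{G}(n,r)$, over all $n!$ permutations of $E$. An $(n,r)$-composition is an integer sequence $(a_0,\ldots,a_r)$ of length $r+1$ with $a_0\ge0$, $a_j>0$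 for $1\le j\le r$, and sum $n$; the compositions displayed in the claim are $(n,r)$-compositions, which fixes the number of ones in each. A flag of $M$ is a chain $X_0\subset X_1\subset\cdots\subset X_r=E$ of flats with $r(X_j)=j$; its composition is $(|X_0|,|X_1-X_0|,\ldots,|X_r-X_{r-1}|)$. $\nu(M;a_0,\ldots,a_r)$ is the number of flags of $M$ with composition $(a_0,\ldots,a_r)$.
   Formalization: The second ν-equation and the claim that only the two displayed compositions differ are stated for r ≥ 2; for r = 1 the composition (0,1,…,1,2,n−r) does not exist and (1,n−1) loses a flag. The G-identity and the first ν-equation are stated for every r. *)

theory Defs
  imports "HOL-Library.Poly_Mapping" "HOL-Combinatorics.Multiset_Permutations"
begin

section \<open>Matroids, presented by their bases\<close>

locale matroid =
  fixes E :: "'a set" and \<B> :: "'a set set"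
  assumes finite_ground: "finite E"
    and bases_nonempty: "\<B> \<noteq> {}"
    and bases_subset: "B \<in> \<B> \<Longrightarrow> B \<subseteq> E"
    and basis_exchange:
      "\<lbrakk>B1 \<in> \<B>; B2 \<in> \<B>; x \<in> B1 - B2\<rbrakk> \<Longrightarrow> \<exists>y \<in> B2 - B1. insert y (B1 - {x}) \<in> \<B>"

definition indep :: "'a set set \<Rightarrow> 'a set \<Rightarrow> bool" where
  "indep \<B> A \<longleftrightarrow> (\<exists>B\<in>\<B>. A \<subseteq> B)"

text \<open>The rank of a set is the size of its largest independent subset; the independent subsets
  of \<open>A\<close> are the subsets of the sets \<open>A \<inter> B\<close>, for \<open>B\<close> a basis.\<close>

definition rank_of :: "'a set set \<Rightarrow> 'a set \<Rightarrow> nat" where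
  "rank_of \<B> A = Max ((\<lambda>B. card (A \<inter> B)) ` \<B>)"

definition circuit :: "'a set \<Rightarrow> 'a set set \<Rightarrow> 'a set \<Rightarrow> bool" where
  "circuit E \<B> C \<longleftrightarrow> C \<subseteq> E \<and> \<not> indep \<B> C \<and> (\<forall>A. A \<subset> C \<longrightarrow> indep \<B> A)"

definition flat :: "'a set \<Rightarrow> 'a set set \<Rightarrow> 'a set \<Rightarrow> bool" where
  "flat E \<B> F \<longleftrightarrow> F \<subseteq> E \<and> (\<forall>e\<in>E - F. rank_of \<B> (insert e F) > rank_of \<B> F)"

text \<open>Written without subtraction, so that a matroid of rank \<open>0\<close> has no hyperplanes.\<close>

definition hyperplane :: "'a set \<Rightarrow> 'a set set \<Rightarrow> 'a set \<Rightarrow> bool" where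
  "hyperplane E \<B> H \<longleftrightarrow> flat E \<B> H \<and> rank_of \<B> H + 1 = rank_of \<B> E"

definition circuit_hyperplane :: "'a set \<Rightarrow> 'a set set \<Rightarrow> 'a set \<Rightarrow> bool" where
  "circuit_hyperplane E \<B> X \<longleftrightarrow> circuit E \<B> X \<and> hyperplane E \<B> X"

text \<open>The bases of the relaxation; the ground set is unchanged.\<close>

definition relaxation :: "'a set set \<Rightarrow> 'a set \<Rightarrow> 'a set set" where
  "relaxation \<B> X = insert X \<B>"

section \<open>The G-invariant\<close>

text \<open>The vector space with basis the symbols \<open>[w]\<close> is the space of finitely supported
  functions on words; \<open>G_space n r\<close> is its subspace spanned by the \<open>0,1\<close>-words
  of length \<open>n\<close> with exactly \<open>r\<close> ones.\<close>

definition zero_one_words :: "nat \<Rightarrow> nat \<Rightarrow> nat list set" where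
  "zero_one_words n r = {w. set w \<subseteq> {0, 1} \<and> length w = n \<and> count_list w 1 = r}"

definition G_space :: "nat \<Rightarrow> nat \<Rightarrow> (nat list \<Rightarrow>\<^sub>0 'k::field_char_0) set" where
  "G_space n r = {f. Poly_Mapping.keys f \<subseteq> zero_one_words n r}"

definition symb :: "nat list \<Rightarrow> (nat list \<Rightarrow>\<^sub>0 'k::field_char_0)" where
  "symb w = Poly_Mapping.single w 1"

definition scale :: "'k::field_char_0 \<Rightarrow> (nat list \<Rightarrow>\<^sub>0 'k) \<Rightarrow> (nat list \<Rightarrow>\<^sub>0 'k)" where
  "scale c f = Poly_Mapping.map (\<lambda>x. c * x) f"

definition rank_sequence :: "'a set set \<Rightarrow> 'a list \<Rightarrow> nat list" where
  "rank_sequence \<B> xs =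
     map (\<lambda>j. rank_of \<B> (set (take (Suc j) xs)) - rank_of \<B> (set (take j xs))) [0..<length xs]"

definition G_invariant :: "'a set \<Rightarrow> 'a set set \<Rightarrow> (nat list \<Rightarrow>\<^sub>0 'k::field_char_0)" where
  "G_invariant E \<B> = (\<Sum>xs\<in>permutations_of_set E. symb (rank_sequence \<B> xs))"

section \<open>Flags and their compositions\<close>

definition is_composition :: "nat \<Rightarrow> nat \<Rightarrow> nat list \<Rightarrow> bool" where
  "is_composition n r a \<longleftrightarrow> length a = r + 1 \<and> (\<forall>j\<in>{1..r}. a ! j > 0) \<and> sum_list a = n"

definition flag :: "'a set \<Rightarrow> 'a set set \<Rightarrow> 'a set list \<Rightarrow> bool" where
  "flag E \<B> Xs \<longleftrightarrow>
     length Xs = rank_of \<B> E + 1 \<and>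
     (\<forall>j\<le>rank_of \<B> E. flat E \<B> (Xs ! j) \<and> rank_of \<B> (Xs ! j) = j) \<and>
     (\<forall>j<rank_of \<B> E. Xs ! j \<subset> Xs ! Suc j) \<and>
     Xs ! rank_of \<B> E = E"

definition composition_of :: "'a set list \<Rightarrow> nat list" where
  "composition_of Xs =
     map (\<lambda>j. if j = 0 then card (Xs ! 0) else card (Xs ! j - Xs ! (j - 1))) [0..<length Xs]"

definition nu :: "'a set \<Rightarrow> 'a set set \<Rightarrow> nat list \<Rightarrow> nat" where
  "nu E \<B> a = card {Xs. flag E \<B> Xs \<and> composition_of Xs = a}"

section \<open>Well-definedness\<close>

lemma lookup_symb: "Poly_Mapping.lookup (symb w) v = (if v = w then 1 else 0)"
  by (simp add: symb_def lookup_single when_def)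

lemma lookup_scale: "Poly_Mapping.lookup (scale c f) v = c * Poly_Mapping.lookup f v"
  by (simp add: scale_def Poly_Mapping.map.rep_eq when_def)

lemma card_swap:
  assumes "finite A" "x \<in> A" "y \<notin> A"
  shows "card (insert y (A - {x})) = card A"
proof -
  have "card (insert y (A - {x})) = Suc (card (A - {x}))" using assms by simp
  also have "\<dots> = card A" using assms by (intro card_Suc_Diff1)
  finally show ?thesis .
qed

context matroid
begin

lemma finite_basis: "B \<in> \<B> \<Longrightarrow> finite B"
  using bases_subset finite_ground finite_subset by blast

lemma finite_bases: "finite \<B>"
  by (rule finite_subset[of _ "Pow E"]) (use bases_subset finite_ground in auto)

lemma card_basis_le: "B1 \<in> \<B> \<Longrightarrow> B2 \<in> \<B> \<Longrightarrow> card B1 \<le> card B2"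
proof (induction "card (B1 - B2)" arbitrary: B1 rule: less_induct)
  case less
  note fin = finite_basis[OF less.prems(1)] finite_basis[OF less.prems(2)]
  show ?case
  proof (cases "B1 \<subseteq> B2")
    case True
    then show ?thesis using fin by (simp add: card_mono)
  next
    case False
    then obtain x where x: "x \<in> B1 - B2" by auto
    from basis_exchange[OF less.prems this] obtain y
      where y: "y \<in> B2 - B1" and B: "insert y (B1 - {x}) \<in> \<B>" by auto
    have eq: "insert y (B1 - {x}) - B2 = (B1 - B2) - {x}" using y by auto
    have "card (insert y (B1 - {x}) - B2) < card (B1 - B2)"
      unfolding eq using x fin by (intro card_Diff1_less) auto
    from less.hyps[OF this B less.prems(2)] have "card (insert y (B1 - {x})) \<le> card B2" .
    moreover have "card (insert y (B1 - {x})) = card B1"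
      using x y fin by (intro card_swap) auto
    ultimately show ?thesis by simp
  qed
qed

lemma card_basis_eq: "B1 \<in> \<B> \<Longrightarrow> B2 \<in> \<B> \<Longrightarrow> card B1 = card B2"
  by (simp add: card_basis_le le_antisym)

lemma rank_of_ge: "B \<in> \<B> \<Longrightarrow> card (A \<inter> B) \<le> rank_of \<B> A"
  unfolding rank_of_def using finite_bases by (intro Max_ge) auto

lemma rank_of_attained: obtains B where "B \<in> \<B>" "rank_of \<B> A = card (A \<inter> B)"
proof -
  have "rank_of \<B> A \<in> (\<lambda>B. card (A \<inter> B)) ` \<B>"
    unfolding rank_of_def using finite_bases bases_nonempty by (intro Max_in) auto
  then show ?thesis using that by auto
qed

lemma card_basis: "B \<in> \<B> \<Longrightarrow> card B = rank_of \<B> E"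
  by (metis rank_of_attained card_basis_eq bases_subset inf.absorb2)

lemma rank_of_mono: "A \<subseteq> C \<Longrightarrow> rank_of \<B> A \<le> rank_of \<B> C"
proof -
  assume "A \<subseteq> C"
  obtain B where B: "B \<in> \<B>" "rank_of \<B> A = card (A \<inter> B)" by (rule rank_of_attained)
  have "card (A \<inter> B) \<le> card (C \<inter> B)"
    using \<open>A \<subseteq> C\<close> finite_basis[OF B(1)] by (intro card_mono) auto
  then show ?thesis using B rank_of_ge[of B C] by simp
qed

lemma rank_of_insert_le: "rank_of \<B> (insert e A) \<le> Suc (rank_of \<B> A)"
proof -
  obtain B where B: "B \<in> \<B>" "rank_of \<B> (insert e A) = card (insert e A \<inter> B)"
    by (rule rank_of_attained)
  have "card (insert e A \<inter> B) \<le> card (insert e (A \<inter> B))"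
    using finite_basis[OF B(1)] by (intro card_mono) auto
  also have "\<dots> \<le> Suc (card (A \<inter> B))"
    by (simp add: card_insert_le_m1 card_insert_if finite_basis[OF B(1)])
  finally show ?thesis using B rank_of_ge[of B A] by simp
qed

lemma rank_of_empty: "rank_of \<B> {} = 0"
  by (metis rank_of_attained Int_empty_left card.empty)

lemma rank_sequence_word:
  assumes "xs \<in> permutations_of_set E"
  shows "rank_sequence \<B> xs \<in> zero_one_words (card E) (rank_of \<B> E)"
proof -
  let ?R = "\<lambda>j. rank_of \<B> (set (take j xs))"
  have len: "length xs = card E"
    using assms length_finite_permutations_of_set by blast
  have step: "?R (Suc j) - ?R j \<in> {0, 1} \<and> ?R j \<le> ?R (Suc j)" if "j < length xs" for j
    using rank_of_insert_le[of "xs ! j" "set (take j xs)"]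
      rank_of_mono[of "set (take j xs)" "insert (xs ! j) (set (take j xs))"] that
    by (auto simp: take_Suc_conv_app_nth)
  have sub: "set (rank_sequence \<B> xs) \<subseteq> {0, 1}"
  proof
    fix k assume "k \<in> set (rank_sequence \<B> xs)"
    then obtain j where j: "j < length xs" "k = ?R (Suc j) - ?R j"
      by (auto simp: rank_sequence_def)
    show "k \<in> {0, 1}" unfolding j(2) by (rule conjunct1[OF step[OF j(1)]])
  qed
  have "sum_list (rank_sequence \<B> xs) = (\<Sum>j<length xs. ?R (Suc j) - ?R j)"
    by (simp add: rank_sequence_def interv_sum_list_conv_sum_set_nat atLeast0LessThan)
  also have "\<dots> = ?R (length xs) - ?R 0"
  proof -
    have "m \<le> length xs \<Longrightarrow> (\<Sum>j<m. ?R (Suc j) - ?R j) + ?R 0 = ?R m" for m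
    proof (induction m)
      case (Suc m)
      then show ?case using step[of m] by simp
    qed simp
    from this[of "length xs"] show ?thesis by simp
  qed
  also have "\<dots> = rank_of \<B> E"
    using assms by (simp add: rank_of_empty permutations_of_setD)
  finally have sum: "sum_list (rank_sequence \<B> xs) = rank_of \<B> E" .
  have "count_list w 1 = sum_list w" if "set w \<subseteq> {0, 1}" for w :: "nat list"
    using that by (induction w) auto
  then show ?thesis
    using sub sum len by (simp add: zero_one_words_def rank_sequence_def)
qed

lemma G_invariant_in_G_space:
  "(G_invariant E \<B> :: nat list \<Rightarrow>\<^sub>0 'b::field_char_0) \<in> G_space (card E) (rank_of \<B> E)"
proof -
  have "Poly_Mapping.keys (\<Sum>xs\<in>permutations_of_set E. symb (rank_sequence \<B> xs) :: nat list \<Rightarrow>\<^sub>0 'b)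
      \<subseteq> (\<Union>xs\<in>permutations_of_set E. Poly_Mapping.keys (symb (rank_sequence \<B> xs) :: nat list \<Rightarrow>\<^sub>0 'b))"
    by (rule keys_sum)
  also have "\<dots> \<subseteq> zero_one_words (card E) (rank_of \<B> E)"
    using rank_sequence_word by (auto simp: symb_def)
  finally show ?thesis by (simp add: G_space_def G_invariant_def)
qed

lemma card_circuit_hyperplane:
  assumes "circuit_hyperplane E \<B> X"
  shows "card X = rank_of \<B> E"
proof -
  have XE: "X \<subseteq> E" and dep: "\<not> indep \<B> X" and sub: "\<And>A. A \<subset> X \<Longrightarrow> indep \<B> A"
    and rk: "rank_of \<B> X + 1 = rank_of \<B> E"
    using assms by (auto simp: circuit_hyperplane_def circuit_def hyperplane_def)
  have fin: "finite X" using XE finite_ground finite_subset by blast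
  obtain x where x: "x \<in> X"
    using dep bases_nonempty by (auto simp: indep_def)
  obtain B where B: "B \<in> \<B>" "X - {x} \<subseteq> B"
    using sub[of "X - {x}"] x by (auto simp: indep_def)
  have "card (X - {x}) \<le> card (X \<inter> B)"
    using B fin by (intro card_mono) auto
  then have ge: "card X \<le> rank_of \<B> X + 1"
    using rank_of_ge[OF B(1), of X] x fin by simp
  obtain B' where B': "B' \<in> \<B>" "rank_of \<B> X = card (X \<inter> B')" by (rule rank_of_attained)
  have "X \<inter> B' \<subset> X" using dep B' by (auto simp: indep_def)
  then have "rank_of \<B> X < card X" using B' fin by (simp add: psubset_card_mono)
  with ge rk show ?thesis by simp
qed

lemma circuit_hyperplane_swap:
  assumes "circuit_hyperplane E \<B> X" and "y \<in> E - X" and "x \<in> X"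
  shows "insert y (X - {x}) \<in> \<B>"
proof -
  have XE: "X \<subseteq> E" and dep: "\<not> indep \<B> X" and sub: "\<And>A. A \<subset> X \<Longrightarrow> indep \<B> A"
    and rk: "rank_of \<B> X + 1 = rank_of \<B> E" and flat: "rank_of \<B> X < rank_of \<B> (insert y X)"
    using assms by (auto simp: circuit_hyperplane_def circuit_def hyperplane_def flat_def)
  note cX = card_circuit_hyperplane[OF assms(1)]
  have fin: "finite X" using XE finite_ground finite_subset by blast
  obtain B' where B': "B' \<in> \<B>" "rank_of \<B> (insert y X) = card (insert y X \<inter> B')"
    by (rule rank_of_attained)
  have "card B' \<le> card (insert y X \<inter> B')"
    using B' flat rk card_basis[OF B'(1)] by simp
  then have "insert y X \<inter> B' = B'"
    using finite_basis[OF B'(1)] by (intro card_seteq) auto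
  then have B'sub: "B' \<subseteq> insert y X" by auto
  obtain B where B: "B \<in> \<B>" "X - {x} \<subseteq> B"
    using sub[of "X - {x}"] assms(3) by (auto simp: indep_def)
  have finB: "finite B" by (rule finite_basis[OF B(1)])
  have "card (B - (X - {x})) = card B - card (X - {x})"
    using B fin by (intro card_Diff_subset) auto
  also have "\<dots> = 1"
    using card_basis[OF B(1)] cX assms(3) fin rk by simp
  finally obtain w where w: "B - (X - {x}) = {w}" by (auto simp: card_1_singleton_iff)
  then have Bw: "B = insert w (X - {x})" and wX: "w \<notin> X - {x}" using B by auto
  have "w \<noteq> x" using dep B(1) Bw assms(3) by (auto simp: indep_def insert_absorb)
  show ?thesis
  proof (cases "w = y")
    case True
    then show ?thesis using B Bw by simp
  next
    case False
    have "w \<in> B - B'" using Bw B'sub wX \<open>w \<noteq> x\<close> False by auto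
    from basis_exchange[OF B(1) B'(1) this] obtain y'
      where y': "y' \<in> B' - B" "insert y' (B - {w}) \<in> \<B>" by auto
    have Bw': "B - {w} = X - {x}" using Bw wX by auto
    have "y' \<noteq> x"
    proof
      assume "y' = x"
      then have "insert y' (B - {w}) = X" using Bw' assms(3) by auto
      then show False using y'(2) dep unfolding indep_def by auto
    qed
    then have "y' = y" using y' B'sub Bw by auto
    then show ?thesis using y'(2) Bw' by simp
  qed
qed

lemma relaxation_matroid:
  assumes "circuit_hyperplane E \<B> X"
  shows "matroid E (relaxation \<B> X)"
proof
  note cX = card_circuit_hyperplane[OF assms]
  have XE: "X \<subseteq> E" using assms by (auto simp: circuit_hyperplane_def circuit_def)
  have fin: "finite X" using XE finite_ground finite_subset by blast
  show "finite E" by (rule finite_ground)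
  show "relaxation \<B> X \<noteq> {}" by (simp add: relaxation_def)
  show "B \<subseteq> E" if "B \<in> relaxation \<B> X" for B
    using that XE bases_subset by (auto simp: relaxation_def)
  fix B1 B2 x
  assume B1: "B1 \<in> relaxation \<B> X" and B2: "B2 \<in> relaxation \<B> X" and x: "x \<in> B1 - B2"
  consider "B1 \<in> \<B>" "B2 \<in> \<B>" | "B1 = X" "B2 \<in> \<B>" | "B1 \<in> \<B>" "B2 = X"
    using B1 B2 x by (auto simp: relaxation_def)
  then show "\<exists>y\<in>B2 - B1. insert y (B1 - {x}) \<in> relaxation \<B> X"
  proof cases
    case 1
    then show ?thesis using basis_exchange[OF 1 x] by (auto simp: relaxation_def)
  next
    case 2
    have "\<not> B2 \<subseteq> X"
      using card_subset_eq[OF fin, of B2] card_basis[OF 2(2)] cX x 2 by auto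
    then obtain y where "y \<in> B2 - X" by auto
    moreover from this have "y \<in> E - X" using bases_subset[OF 2(2)] by auto
    ultimately show ?thesis
      using circuit_hyperplane_swap[OF assms, of y x] x 2 by (auto simp: relaxation_def)
  next
    case 3
    note fB = finite_basis[OF 3(1)]
    show ?thesis
    proof (cases "B1 - {x} \<subseteq> X")
      case True
      have "\<not> X \<subseteq> B1"
        using card_subset_eq[OF fB, of X] card_basis[OF 3(1)] cX x 3 by auto
      then obtain y where y: "y \<in> X - B1" by auto
      have "card (insert y (B1 - {x})) = card X"
        using card_swap[OF fB, of x y] y x cX card_basis[OF 3(1)] by simp
      then have "insert y (B1 - {x}) = X"
        using True y fin by (intro card_subset_eq) auto
      then show ?thesis using y 3 by (auto simp: relaxation_def)
    next
      case False
      then obtain w where w: "w \<in> B1" "w \<noteq> x" "w \<notin> X" by auto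
      have "X \<noteq> {}" using assms 3 by (auto simp: circuit_hyperplane_def circuit_def indep_def)
      then obtain z where z: "z \<in> X" by auto
      have S: "insert w (X - {z}) \<in> \<B>"
        using circuit_hyperplane_swap[OF assms _ z] w bases_subset[OF 3(1)] by auto
      have "x \<in> B1 - insert w (X - {z})" using x w 3 by auto
      from basis_exchange[OF 3(1) S this] show ?thesis
        using w 3 by (auto simp: relaxation_def)
    qed
  qed
qed

lemma finite_flags: "finite {Xs. flag E \<B> Xs}"
proof (rule finite_subset)
  show "{Xs. flag E \<B> Xs} \<subseteq> {Xs. set Xs \<subseteq> Pow E \<and> length Xs = rank_of \<B> E + 1}"
  proof
    fix Xs assume "Xs \<in> {Xs. flag E \<B> Xs}"
    then have len: "length Xs = rank_of \<B> E + 1"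
      and sub: "j \<le> rank_of \<B> E \<Longrightarrow> Xs ! j \<subseteq> E" for j
      by (simp_all add: flag_def flat_def)
    have "set Xs \<subseteq> Pow E"
    proof
      fix Y assume "Y \<in> set Xs"
      then obtain j where "j < length Xs" "Y = Xs ! j" by (metis in_set_conv_nth)
      then show "Y \<in> Pow E" using len sub[of j] by simp
    qed
    with len show "Xs \<in> {Xs. set Xs \<subseteq> Pow E \<and> length Xs = rank_of \<B> E + 1}" by simp
  qed
  show "finite {Xs. set Xs \<subseteq> Pow E \<and> length Xs = rank_of \<B> E + 1}"
    using finite_ground by (intro finite_lists_length_eq) auto
qed

end

end

theory Submission
  imports Defs
begin

text \<open>
  The rank function of the relaxation agrees with that of the matroid except at \<open>X\<close>, whose rank
  rises from \<open>r - 1\<close> to \<open>r\<close>. Hence only the \<open>r! (n - r)!\<close> permutations that list \<open>X\<close> first change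
  their rank sequence. Among the flats, relaxing trades the hyperplane \<open>X\<close> for the hyperplanes
  \<open>X - {x}\<close>. As all smaller subsets of \<open>X\<close> are independent flats of both matroids, the flags lost
  and gained are the chains of subsets of \<open>X\<close> growing one element at a time, of lengths \<open>r - 1\<close>
  and \<open>r\<close>; they correspond to injective words in \<open>X\<close> of lengths \<open>r - 2\<close> and \<open>r - 1\<close>.
\<close>

section \<open>Counting orderings with a given prefix, and chains of subsets\<close>

text \<open>Cutting after position \<open>card X\<close> turns such an ordering into an ordering of
  \<open>X\<close> and an independent ordering of \<open>E - X\<close>.\<close>

lemma card_permutations_prefix:
  assumes "finite E" "X \<subseteq> E"
  shows "card {xs \<in> permutations_of_set E. set (take (card X) xs) = X}
    = fact (card X) * fact (card E - card X)"
proof -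
  have fin: "finite X" using assms finite_subset by blast
  have "{xs \<in> permutations_of_set E. set (take (card X) xs) = X} =
    (\<lambda>(ys, zs). ys @ zs) ` (permutations_of_set X \<times> permutations_of_set (E - X))" (is "?L = ?R")
  proof (intro set_eqI iffI)
    fix xs assume "xs \<in> ?L"
    then have xs: "set xs = E" "distinct xs" "set (take (card X) xs) = X"
      by (auto simp: permutations_of_set_def)
    then have "distinct (take (card X) xs @ drop (card X) xs)"
      "set (take (card X) xs @ drop (card X) xs) = E" by simp_all
    then have "set (drop (card X) xs) = E - X" "distinct (drop (card X) xs)"
      "distinct (take (card X) xs)"
      unfolding distinct_append set_append xs(3) by blast+
    then have "(take (card X) xs, drop (card X) xs)
        \<in> permutations_of_set X \<times> permutations_of_set (E - X)"
      using xs by (simp add: permutations_of_set_def)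
    then show "xs \<in> ?R" by (intro image_eqI[where x = "(take (card X) xs, drop (card X) xs)"]) auto
  next
    fix xs assume "xs \<in> ?R"
    then obtain ys zs where "xs = ys @ zs" "set ys = X" "distinct ys" "set zs = E - X" "distinct zs"
      by (auto simp: permutations_of_set_def)
    moreover from this have "length ys = card X" using distinct_card by metis
    ultimately show "xs \<in> ?L" using assms by (auto simp: permutations_of_set_def)
  qed
  \<comment> \<open>The cut can be recovered because all orderings of \<open>X\<close> have the same
    length.\<close>
  moreover have "inj_on (\<lambda>(ys, zs). ys @ zs)
      (permutations_of_set X \<times> permutations_of_set (E - X))"
    by (rule inj_onI) (auto simp: length_finite_permutations_of_set)
  ultimately show ?thesis
    using assms fin by (simp add: card_image card_cartesian_product card_Diff_subset)
qed

lemma distinct_nth_notin_take: "distinct xs \<Longrightarrow> i < length xs \<Longrightarrow> xs ! i \<notin> set (take i xs)"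
  by (auto simp: in_set_conv_nth distinct_conv_nth)

text \<open>For finite \<open>A\<close> and \<open>k \<le> card A\<close> these are the bottom
  parts, up to rank \<open>k\<close>, of the maximal chains in the Boolean lattice of
  \<open>A\<close>, indexed by size in the same way as \<open>flag\<close> indexes flats by
  rank.\<close>

definition subset_chains :: "'a set \<Rightarrow> nat \<Rightarrow> 'a set list set" where
  "subset_chains A k = {Ys. length Ys = Suc k \<and> (\<forall>j\<le>k. Ys ! j \<subseteq> A \<and> card (Ys ! j) = j) \<and>
     (\<forall>j<k. Ys ! j \<subset> Ys ! Suc j)}"

text \<open>Each set exceeds its predecessor by a single element, so the added elements, listed in
  order, form a word whose prefix sets are the chain.\<close>

lemma subset_chains_eq_image:
  assumes "finite A"
  shows "subset_chains A k = (\<lambda>xs. map (\<lambda>j. set (take j xs)) [0..<Suc k]) `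
    {xs. length xs = k \<and> distinct xs \<and> set xs \<subseteq> A}" (is "_ = ?f ` ?D")
proof (intro set_eqI iffI)
  fix Ys assume "Ys \<in> subset_chains A k"
  then have len: "length Ys = Suc k" and sub: "\<And>j. j \<le> k \<Longrightarrow> Ys ! j \<subseteq> A"
    and card: "\<And>j. j \<le> k \<Longrightarrow> card (Ys ! j) = j" and mono: "\<And>j. j < k \<Longrightarrow> Ys ! j \<subset> Ys ! Suc j"
    by (auto simp: subset_chains_def)
  have fin: "finite (Ys ! j)" if "j \<le> k" for j using sub[OF that] assms finite_subset by blast
  have "\<exists>x. Ys ! Suc j = insert x (Ys ! j)" if "j < k" for j
  proof -
    have "card (Ys ! Suc j - Ys ! j) = 1"
      using card[of j] card[of "Suc j"] mono[of j] fin[of j] that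
      by (subst card_Diff_subset) auto
    then obtain x where "Ys ! Suc j - Ys ! j = {x}" by (auto simp: card_1_singleton_iff)
    then have "Ys ! Suc j = insert x (Ys ! j)" using mono[OF that] by blast
    then show ?thesis ..
  qed
  then obtain f where f: "\<And>j. j < k \<Longrightarrow> Ys ! Suc j = insert (f j) (Ys ! j)" by metis
  have Ys: "Ys ! j = f ` {..<j}" if "j \<le> k" for j
    using that
  proof (induction j)
    case 0
    \<comment> \<open>Since \<open>card\<close> is 0 on infinite sets as well, finiteness is what
      makes the first set empty.\<close>
    then show ?case using card[of 0] fin[of 0] by simp
  next
    case (Suc j)
    then show ?case using f[of j] by (simp add: lessThan_Suc)
  qed
  have "inj_on f {..<k}" using card[of k] Ys[of k] by (intro eq_card_imp_inj_on) auto
  then have D: "map f [0..<k] \<in> ?D"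
    using sub[of k] Ys[of k] by (simp add: distinct_map atLeast0LessThan)
  have "Ys = ?f (map f [0..<k])"
    by (rule nth_equalityI) (auto simp: len Ys take_map atLeast0LessThan simp del: upt_Suc)
  with D show "Ys \<in> ?f ` ?D" by blast
next
  fix Ys assume "Ys \<in> ?f ` ?D"
  then obtain xs where xs: "length xs = k" "distinct xs" "set xs \<subseteq> A" "Ys = ?f xs" by blast
  have "card (set (take j xs)) = j" if "j \<le> k" for j
    using xs that by (simp add: distinct_card)
  moreover have "set (take j xs) \<subset> set (take (Suc j) xs)" if "j < k" for j
    using xs that distinct_nth_notin_take[of xs j] by (auto simp: take_Suc_conv_app_nth)
  moreover have "set (take j xs) \<subseteq> A" for j
    using xs(3) set_take_subset[of j xs] by blast
  ultimately show "Ys \<in> subset_chains A k"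
    unfolding subset_chains_def using xs(1,4) by (simp del: upt_Suc)
qed

text \<open>The word is determined by the chain, its letter \<open>i\<close> being the only element
  of prefix set \<open>i + 1\<close> outside prefix set \<open>i\<close>. Chains are therefore
  counted by the falling factorial for injective words.\<close>

lemma card_subset_chains:
  assumes "finite A" "k \<le> card A"
  shows "card (subset_chains A k) = \<Prod>{card A - k + 1..card A}"
proof -
  have "inj_on (\<lambda>xs. map (\<lambda>j. set (take j xs)) [0..<Suc k])
    {xs. length xs = k \<and> distinct xs \<and> set xs \<subseteq> A}"
  proof (rule inj_onI, rule nth_equalityI; clarsimp simp del: upt_Suc)
    fix xs ys :: "'a list" and i
    assume "distinct xs" "distinct ys" "length ys = length xs" "k = length xs" "i < length xs"
      and eq: "\<forall>j\<in>{0..<Suc (length xs)}. set (take j xs) = set (take j ys)"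
    then have "set (take (Suc i) xs) - set (take i xs) = {xs ! i}"
      "set (take (Suc i) ys) - set (take i ys) = {ys ! i}"
      using distinct_nth_notin_take[of xs i] distinct_nth_notin_take[of ys i]
      by (simp_all add: take_Suc_conv_app_nth insert_Diff_if)
    moreover have "set (take (Suc i) xs) = set (take (Suc i) ys)" "set (take i xs) = set (take i ys)"
      using eq \<open>i < length xs\<close> by auto
    ultimately show "xs ! i = ys ! i" by auto
  qed
  then show ?thesis
    using card_lists_distinct_length_eq[OF assms]
    by (simp add: subset_chains_eq_image[OF assms(1)] card_image del: upt_Suc)
qed

section \<open>The rank function of the relaxation\<close>

context matroid
begin

lemma rank_of_le_card: "finite A \<Longrightarrow> rank_of \<B> A \<le> card A"
  by (metis rank_of_attained card_mono inf_le1)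

lemma rank_of_indep:
  assumes "indep \<B> A"
  shows "rank_of \<B> A = card A"
proof -
  obtain B where B: "B \<in> \<B>" "A \<subseteq> B" using assms by (auto simp: indep_def)
  then have "finite A" "A \<inter> B = A" using finite_basis finite_subset by auto
  then show ?thesis using rank_of_ge[OF B(1), of A] rank_of_le_card[of A] by simp
qed

lemma flat_ground: "flat E \<B> E"
  by (simp add: flat_def)

end

locale circuit_hyperplane_matroid = matroid E \<B> for E :: "'a set" and \<B> +
  fixes X :: "'a set"
  assumes circuit_hyperplane: "circuit_hyperplane E \<B> X"
begin

abbreviation "r \<equiv> rank_of \<B> E"
abbreviation "\<B>' \<equiv> relaxation \<B> X"

sublocale relax: matroid E \<B>'
  by (rule relaxation_matroid[OF circuit_hyperplane])

lemma X_subset: "X \<subseteq> E" and flat_X: "flat E \<B> X" and rank_X: "rank_of \<B> X + 1 = r"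
  and indep_subset_X: "A \<subset> X \<Longrightarrow> indep \<B> A"
  using circuit_hyperplane by (auto simp: circuit_hyperplane_def circuit_def hyperplane_def)

lemma finite_X: "finite X"
  using X_subset finite_ground finite_subset by blast

lemma card_X: "card X = r"
  by (rule card_circuit_hyperplane[OF circuit_hyperplane])

lemma X_psubset: "X \<subset> E"
  using X_subset rank_X by auto

lemma rank_pos: "r > 0"
  using rank_X by simp

lemma rank_less_card: "r < card E"
  using psubset_card_mono[OF finite_ground X_psubset] card_X by simp

lemma rank_psubset_X: "A \<subset> X \<Longrightarrow> rank_of \<B> A = card A"
  by (rule rank_of_indep[OF indep_subset_X])

text \<open>For \<open>x \<in> X - A\<close> the set lies inside \<open>insert y (X - {x})\<close>,
  which is a basis by \<open>circuit_hyperplane_swap\<close>.\<close>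

lemma rank_insert_outside:
  assumes "A \<subset> X" "y \<in> E - X"
  shows "rank_of \<B> (insert y A) = Suc (card A)"
proof -
  obtain x where x: "x \<in> X - A" using assms by auto
  then have "insert y A \<subseteq> insert y (X - {x})" using assms by auto
  then have "indep \<B> (insert y A)"
    using circuit_hyperplane_swap[OF circuit_hyperplane assms(2), of x] x by (auto simp: indep_def)
  moreover have "finite A" "y \<notin> A" using assms finite_X finite_subset by auto
  ultimately show ?thesis by (simp add: rank_of_indep)
qed

text \<open>As \<open>X\<close> is a flat of rank \<open>r - 1\<close>, a single further element
  already raises the rank to the maximum.\<close>

lemma rank_psupset_X:
  assumes "X \<subset> A" "A \<subseteq> E"
  shows "rank_of \<B> A = r"
proof -
  obtain y where y: "y \<in> A - X" using assms by auto
  then have "rank_of \<B> X < rank_of \<B> (insert y X)" using flat_X assms by (auto simp: flat_def)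
  also have "\<dots> \<le> rank_of \<B> A" using y assms by (intro rank_of_mono) auto
  finally show ?thesis using rank_X rank_of_mono[OF assms(2)] by simp
qed

text \<open>The new basis \<open>X\<close> contributes only the value
  \<open>card (A \<inter> X)\<close> to the maximum. If \<open>A\<close> does not contain
  \<open>X\<close>, this intersection is independent and the old rank is at least as large; if
  \<open>A\<close> properly contains \<open>X\<close>, the old rank is already
  \<open>r\<close>.\<close>

lemma rank_relaxation:
  assumes "A \<subseteq> E"
  shows "rank_of \<B>' A = (if A = X then r else rank_of \<B> A)"
proof -
  have max: "rank_of \<B>' A = max (card (A \<inter> X)) (rank_of \<B> A)"
    unfolding rank_of_def relaxation_def using finite_bases bases_nonempty by simp
  consider "A = X" | "A \<inter> X \<subset> X" | "X \<subset> A" by blast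
  then show ?thesis
  proof cases
    case 1
    then show ?thesis using max card_X rank_X by simp
  next
    case 2
    then have "card (A \<inter> X) \<le> rank_of \<B> A"
      using rank_psubset_X[OF 2] rank_of_mono[of "A \<inter> X" A] by simp
    then show ?thesis using max 2 by auto
  next
    case 3
    then have "A \<inter> X = X" by auto
    then show ?thesis using max 3 rank_psupset_X[OF 3 assms] card_X by auto
  qed
qed

lemma rank_relaxation_ground: "rank_of \<B>' E = r"
  using rank_relaxation[of E] by auto

lemma rank_relaxation_subset_X: "A \<subseteq> X \<Longrightarrow> rank_of \<B>' A = card A"
  using rank_relaxation[of A] rank_psubset_X[of A] X_subset card_X by auto


subsection \<open>The G-invariant\<close>

text \<open>A prefix equal to \<open>X\<close> must have length \<open>card X = r\<close>, so here
  no prefix meets the one set whose rank changes.\<close>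

lemma rank_sequence_relaxation_eq:
  assumes "xs \<in> permutations_of_set E" "set (take r xs) \<noteq> X"
  shows "rank_sequence \<B>' xs = rank_sequence \<B> xs"
proof -
  have "set (take j xs) \<noteq> X" if "j \<le> length xs" for j
  proof
    assume eq: "set (take j xs) = X"
    have "distinct xs" using assms by (simp add: permutations_of_setD)
    then have "card X = j" using that eq distinct_card[of "take j xs"] by simp
    then show False using eq assms(2) card_X by simp
  qed
  moreover have "set (take j xs) \<subseteq> E" for j
    using assms(1) set_take_subset[of j xs] by (auto simp: permutations_of_set_def)
  ultimately have "rank_of \<B>' (set (take j xs)) = rank_of \<B> (set (take j xs))"
    if "j \<le> length xs" for j
    using that rank_relaxation by simp
  then show ?thesis by (simp add: rank_sequence_def)
qed

text \<open>Prefixes shorter than \<open>r\<close> are proper subsets of \<open>X\<close>, hence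
  independent; longer ones properly contain \<open>X\<close>, hence have full rank. The two matroids
  disagree only at the prefix \<open>X\<close> itself.\<close>

lemma rank_sequences_prefix_X:
  assumes "xs \<in> permutations_of_set E" "set (take r xs) = X"
  shows "rank_sequence \<B> xs = replicate (r - 1) 1 @ [0, 1] @ replicate (card E - r - 1) 0" (is ?old)
    and "rank_sequence \<B>' xs = replicate r 1 @ replicate (card E - r) 0" (is ?new)
proof -
  have xs: "distinct xs" "set xs = E" "length xs = card E"
    using assms(1) length_finite_permutations_of_set by (auto simp: permutations_of_set_def)
  have cardj: "card (set (take j xs)) = j" if "j \<le> card E" for j
    using that xs by (simp add: distinct_card)
  have less: "set (take j xs) \<subset> X" if "j < r" for j
  proof -
    have "set (take j xs) \<subseteq> X" using assms(2) that set_take_subset_set_take[of j r xs] by simp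
    moreover have "set (take j xs) \<noteq> X" using cardj[of j] that rank_less_card card_X by auto
    ultimately show ?thesis by blast
  qed
  have greater: "rank_of \<B> (set (take j xs)) = r" "rank_of \<B>' (set (take j xs)) = r"
    if "r < j" "j \<le> card E" for j
  proof -
    have "X \<subseteq> set (take j xs)" using assms(2) that set_take_subset_set_take[of r j xs] by simp
    moreover have ne: "set (take j xs) \<noteq> X" using cardj[of j] that card_X by auto
    moreover have sub: "set (take j xs) \<subseteq> E" using xs set_take_subset[of j xs] by simp
    ultimately show "rank_of \<B> (set (take j xs)) = r" using rank_psupset_X by blast
    then show "rank_of \<B>' (set (take j xs)) = r" using rank_relaxation[OF sub] ne by simp
  qed
  have rk: "rank_of \<B> (set (take j xs)) = (if j < r then j else if j = r then r - 1 else r)"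
    and rk': "rank_of \<B>' (set (take j xs)) = min j r" if "j \<le> card E" for j
    using less[of j] greater[of j] rank_psubset_X[OF less, of j] cardj[OF that] that assms(2)
      rank_X rank_relaxation_subset_X[of "set (take j xs)"] card_X
    by (cases j r rule: linorder_cases; force)+
  have len: "length (rank_sequence \<B> xs) = card E" "length (rank_sequence \<B>' xs) = card E"
    using xs by (simp_all add: rank_sequence_def)
  show ?old
  proof (rule nth_equalityI)
    show "length (rank_sequence \<B> xs)
        = length (replicate (r - 1) 1 @ [0, 1] @ replicate (card E - r - 1) (0::nat))"
      using len rank_less_card rank_pos by simp
    fix i assume "i < length (rank_sequence \<B> xs)"
    then have i: "i < card E" using len by simp
    then have "rank_sequence \<B> xs ! i
        = rank_of \<B> (set (take (Suc i) xs)) - rank_of \<B> (set (take i xs))"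
      using xs(3) by (simp add: rank_sequence_def)
    \<comment> \<open>Counting from 0, entry \<open>r - 1\<close> compares the prefixes of lengths
      \<open>r - 1\<close> and \<open>r\<close>, both of rank \<open>r - 1\<close>; the missing one
      is made up at entry \<open>r\<close>.\<close>
    also have "\<dots> = (if i < r - 1 then 1 else if i = r then 1 else 0)"
      using i rank_pos by (auto simp: rk)
    also have "\<dots> = (replicate (r - 1) 1 @ [0, 1] @ replicate (card E - r - 1) 0) ! i"
      using i rank_pos by (auto simp: nth_append nth_Cons split: nat.splits)
    finally show "rank_sequence \<B> xs ! i = \<dots>" .
  qed
  show ?new
  proof (rule nth_equalityI)
    show "length (rank_sequence \<B>' xs) = length (replicate r 1 @ replicate (card E - r) (0::nat))"
      using len rank_less_card by simp
    fix i assume "i < length (rank_sequence \<B>' xs)"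
    then have i: "i < card E" using len by simp
    then have "rank_sequence \<B>' xs ! i
        = rank_of \<B>' (set (take (Suc i) xs)) - rank_of \<B>' (set (take i xs))"
      using xs(3) by (simp add: rank_sequence_def)
    also have "\<dots> = (replicate r 1 @ replicate (card E - r) 0) ! i"
      using i by (auto simp: rk' nth_append)
    finally show "rank_sequence \<B>' xs ! i = \<dots>" .
  qed
qed

text \<open>Subtracting ordering by ordering, only those starting with \<open>X\<close> survive, and
  all of them contribute the same difference of symbols.\<close>

lemma G_invariant_relaxation:
  "(G_invariant E \<B>' - G_invariant E \<B> :: nat list \<Rightarrow>\<^sub>0 'k::field_char_0) =
     scale (fact r * fact (card E - r))
       (symb (replicate r 1 @ replicate (card E - r) 0)
        - symb (replicate (r - 1) 1 @ [0, 1] @ replicate (card E - r - 1) 0))"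
  (is "_ = scale _ (symb ?new - symb ?old)")
proof -
  let ?P = "{xs \<in> permutations_of_set E. set (take r xs) = X}"
  let ?d = "\<lambda>xs. symb (rank_sequence \<B>' xs) - symb (rank_sequence \<B> xs) :: nat list \<Rightarrow>\<^sub>0 'k"
  have "(G_invariant E \<B>' - G_invariant E \<B> :: nat list \<Rightarrow>\<^sub>0 'k) = sum ?d (permutations_of_set E)"
    by (simp add: G_invariant_def sum_subtractf)
  also have "\<dots> = sum ?d ?P"
    using rank_sequence_relaxation_eq by (intro sum.mono_neutral_right) auto
  also have "\<dots> = (\<Sum>xs\<in>?P. symb ?new - symb ?old)"
    using rank_sequences_prefix_X by (intro sum.cong) auto
  also have "\<dots> = scale (of_nat (card ?P)) (symb ?new - symb ?old)"
    by (rule poly_mapping_eqI) (simp add: lookup_scale lookup_sum)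
  also have "card ?P = fact r * fact (card E - r)"
    using card_permutations_prefix[OF finite_ground X_subset] card_X by simp
  finally show ?thesis by simp
qed


subsection \<open>Flags\<close>

text \<open>In the relaxation, a proper subset of \<open>X\<close> stays independent when any one
  element of \<open>E\<close> is added, whether inside or outside \<open>X\<close>.\<close>

lemma flat_relaxation_psubset_X:
  assumes "A \<subset> X"
  shows "flat E \<B>' A"
proof -
  have "finite A" using assms finite_X finite_subset by blast
  have "rank_of \<B>' (insert e A) = Suc (card A)" if e: "e \<in> E - A" for e
  proof (cases "e \<in> X")
    case True
    then show ?thesis
      using rank_relaxation_subset_X[of "insert e A"] assms e \<open>finite A\<close> by auto
  next
    case False
    then have "insert e A \<noteq> X" "insert e A \<subseteq> E" using assms X_subset e by auto
    then show ?thesis using rank_insert_outside[OF assms, of e] rank_relaxation e False by auto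
  qed
  then show ?thesis
    using assms X_subset rank_relaxation_subset_X[of A] by (auto simp: flat_def)
qed

text \<open>At least two elements of \<open>X\<close> are missing from \<open>A\<close>, so adding
  one of them still leaves a proper, hence independent, subset of the circuit.\<close>

lemma flat_small_subset_X:
  assumes "A \<subseteq> X" "Suc (card A) < r"
  shows "flat E \<B> A"
proof -
  have fin: "finite A" using assms finite_X finite_subset by blast
  have A: "A \<subset> X" using assms card_X by auto
  have "rank_of \<B> (insert e A) = Suc (card A)" if e: "e \<in> E - A" for e
  proof (cases "e \<in> X")
    case True
    have "card (insert e A) = Suc (card A)" using fin e by simp
    moreover from this have "insert e A \<subset> X" using True A assms(2) card_X by auto
    ultimately show ?thesis using rank_psubset_X by simp
  next
    case False
    then show ?thesis using rank_insert_outside[OF A, of e] e by auto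
  qed
  then show ?thesis using A X_subset rank_psubset_X[OF A] by (auto simp: flat_def)
qed

text \<open>Putting \<open>x\<close> back gives the circuit \<open>X\<close>, whose rank is still
  \<open>r - 1\<close>.\<close>

lemma not_flat_remove:
  assumes "x \<in> X"
  shows "\<not> flat E \<B> (X - {x})"
proof
  assume "flat E \<B> (X - {x})"
  then have "rank_of \<B> (X - {x}) < rank_of \<B> (insert x (X - {x}))"
    using assms X_subset unfolding flat_def by blast
  moreover have "rank_of \<B> (X - {x}) = r - 1"
    using assms rank_psubset_X[of "X - {x}"] card_X finite_X by auto
  ultimately show False using rank_X assms by (simp add: insert_absorb)
qed

text \<open>After relaxing, \<open>X\<close> has full rank but is not the whole ground set.\<close>

lemma not_flat_relaxation_X: "\<not> flat E \<B>' X"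
proof
  assume flat: "flat E \<B>' X"
  obtain y where y: "y \<in> E - X" using X_psubset by auto
  then have "rank_of \<B>' X < rank_of \<B>' (insert y X)" using flat by (auto simp: flat_def)
  moreover have "rank_of \<B>' (insert y X) \<le> rank_of \<B>' E"
    using y X_subset by (intro relax.rank_of_mono) auto
  ultimately show False using rank_relaxation[OF X_subset] rank_relaxation_ground by simp
qed

text \<open>Flatness compares the ranks of \<open>F\<close> and \<open>insert e F\<close>. As only
  the rank of \<open>X\<close> changes, the status of \<open>F\<close> can change only if
  \<open>F\<close> is \<open>X\<close> or lacks exactly one element of it.\<close>

lemma flat_relaxation_iff:
  "flat E \<B>' F \<longleftrightarrow> flat E \<B> F \<and> F \<noteq> X \<or> (\<exists>x\<in>X. F = X - {x})"
proof
  assume flat': "flat E \<B>' F"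
  then have FE: "F \<subseteq> E" and FX: "F \<noteq> X" using not_flat_relaxation_X by (auto simp: flat_def)
  show "flat E \<B> F \<and> F \<noteq> X \<or> (\<exists>x\<in>X. F = X - {x})"
  proof (cases "flat E \<B> F")
    case False
    then obtain e where e: "e \<in> E - F" "\<not> rank_of \<B> (insert e F) > rank_of \<B> F"
      using FE by (auto simp: flat_def)
    have "rank_of \<B>' (insert e F) > rank_of \<B>' F" using flat' e by (auto simp: flat_def)
    \<comment> \<open>The comparison is strict only after relaxing, so one of the two sets is
      \<open>X\<close>, and \<open>F\<close> is not.\<close>
    then have "insert e F = X"
      using e FE FX rank_relaxation[of F] rank_relaxation[of "insert e F"] by (auto split: if_splits)
    then show ?thesis using e by auto
  qed (use FX in simp)
next
  assume "flat E \<B> F \<and> F \<noteq> X \<or> (\<exists>x\<in>X. F = X - {x})"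
  then show "flat E \<B>' F"
  proof
    assume F: "flat E \<B> F \<and> F \<noteq> X"
    have "rank_of \<B>' F < rank_of \<B>' (insert e F)" if e: "e \<in> E - F" for e
    proof -
      have FE: "F \<subseteq> E" and "rank_of \<B> F < rank_of \<B> (insert e F)"
        using F e by (auto simp: flat_def)
      \<comment> \<open>Only the rank of \<open>insert e F\<close> can change, and it can only go
        up.\<close>
      then show ?thesis
        using rank_relaxation[of F] rank_relaxation[of "insert e F"] F e rank_X by auto
    qed
    then show ?thesis using F by (auto simp: flat_def)
  qed (use flat_relaxation_psubset_X in blast)
qed

section \<open>Flags lost and gained\<close>

lemma flag_iff:
  "flag E \<B> Xs \<longleftrightarrow> length Xs = Suc r \<and> (\<forall>j\<le>r. flat E \<B> (Xs ! j) \<and> rank_of \<B> (Xs ! j) = j) \<and>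
    (\<forall>j<r. Xs ! j \<subset> Xs ! Suc j) \<and> Xs ! r = E"
  by (simp add: flag_def)

lemma flag_relaxation_iff:
  "flag E \<B>' Xs \<longleftrightarrow> length Xs = Suc r \<and> (\<forall>j\<le>r. flat E \<B>' (Xs ! j) \<and> rank_of \<B>' (Xs ! j) = j) \<and>
    (\<forall>j<r. Xs ! j \<subset> Xs ! Suc j) \<and> Xs ! r = E"
  by (simp add: flag_def rank_relaxation_ground)

lemma chain_mono:
  assumes "\<And>j. j < m \<Longrightarrow> Xs ! j \<subset> Xs ! Suc j" "i \<le> j" "j \<le> m"
  shows "Xs ! i \<subseteq> Xs ! j"
  using assms(2,3)
proof (induction j rule: dec_induct)
  case (step j)
  then show ?case using assms(1)[of j] by auto
qed simp

text \<open>A flag avoiding \<open>X\<close> keeps its flats and their ranks, so it survives. The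
  rank of \<open>X\<close> in the original matroid fixes its position.\<close>

lemma lost_flag_hyperplane:
  assumes "flag E \<B> Xs" "\<not> flag E \<B>' Xs"
  shows "Xs ! (r - 1) = X"
proof -
  have F: "\<And>j. j \<le> r \<Longrightarrow> flat E \<B> (Xs ! j)" "\<And>j. j \<le> r \<Longrightarrow> rank_of \<B> (Xs ! j) = j"
    using assms(1) by (auto simp: flag_iff)
  have "\<exists>j\<le>r. Xs ! j = X"
  proof (rule ccontr)
    assume ne: "\<not> (\<exists>j\<le>r. Xs ! j = X)"
    have "flat E \<B>' (Xs ! j) \<and> rank_of \<B>' (Xs ! j) = j" if "j \<le> r" for j
    proof -
      have "Xs ! j \<noteq> X" "Xs ! j \<subseteq> E" using ne that F(1)[OF that] by (auto simp: flat_def)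
      then show ?thesis using F[OF that] flat_relaxation_iff rank_relaxation by simp
    qed
    then show False using assms by (simp add: flag_iff flag_relaxation_iff)
  qed
  then obtain j where j: "j \<le> r" "Xs ! j = X" by blast
  then have "j = r - 1" using F(2)[OF j(1)] rank_X by simp
  with j show ?thesis by simp
qed

text \<open>A new flag must use a new flat, and these are the sets \<open>X - {x}\<close>, of rank
  \<open>r - 1\<close>.\<close>

lemma gained_flag_hyperplane:
  assumes "flag E \<B>' Xs" "\<not> flag E \<B> Xs"
  shows "\<exists>x\<in>X. Xs ! (r - 1) = X - {x}"
proof -
  have F: "\<And>j. j \<le> r \<Longrightarrow> flat E \<B>' (Xs ! j)" "\<And>j. j \<le> r \<Longrightarrow> rank_of \<B>' (Xs ! j) = j"
    using assms(1) by (auto simp: flag_relaxation_iff)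
  have "\<exists>j\<le>r. \<exists>x\<in>X. Xs ! j = X - {x}"
  proof (rule ccontr)
    assume ne: "\<not> (\<exists>j\<le>r. \<exists>x\<in>X. Xs ! j = X - {x})"
    have "flat E \<B> (Xs ! j) \<and> rank_of \<B> (Xs ! j) = j" if "j \<le> r" for j
    proof -
      have "flat E \<B> (Xs ! j)" "Xs ! j \<noteq> X" "Xs ! j \<subseteq> E"
        using ne that F(1)[OF that] flat_relaxation_iff by (auto simp: flat_def)
      then show ?thesis using F(2)[OF that] rank_relaxation by simp
    qed
    then show False using assms by (simp add: flag_iff flag_relaxation_iff)
  qed
  then obtain j x where j: "j \<le> r" "x \<in> X" "Xs ! j = X - {x}" by blast
  then have "j = r - 1"
    using F(2)[OF j(1)] rank_relaxation_subset_X[of "X - {x}"] card_X finite_X by auto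
  with j show ?thesis by auto
qed

text \<open>Below \<open>X - {x}\<close> everything lies in \<open>X\<close>, where the relaxed rank
  is cardinality, so the flag grows by single elements. Conversely, such chains consist of flats of
  the relaxation, and their sets of size \<open>r - 1\<close> are not flats of the original
  matroid.\<close>

lemma gained_flags:
  "{Xs. flag E \<B>' Xs \<and> \<not> flag E \<B> Xs} = (\<lambda>Ys. Ys @ [E]) ` subset_chains X (r - 1)"
proof (intro set_eqI iffI)
  fix Xs assume "Xs \<in> {Xs. flag E \<B>' Xs \<and> \<not> flag E \<B> Xs}"
  then have Xs: "flag E \<B>' Xs" "\<not> flag E \<B> Xs" by auto
  then obtain x where x: "x \<in> X" "Xs ! (r - 1) = X - {x}" using gained_flag_hyperplane by blast
  have len: "length Xs = Suc r" and rk: "\<And>j. j \<le> r \<Longrightarrow> rank_of \<B>' (Xs ! j) = j"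
    and mono: "\<And>j. j < r \<Longrightarrow> Xs ! j \<subset> Xs ! Suc j" and top: "Xs ! r = E"
    using Xs(1) by (auto simp: flag_relaxation_iff)
  have sub: "Xs ! j \<subseteq> X" if "j \<le> r - 1" for j
    using chain_mono[of r Xs j "r - 1", OF mono] x that by auto
  then have "card (Xs ! j) = j" if "j \<le> r - 1" for j
    using rank_relaxation_subset_X[OF sub[OF that]] rk[of j] that by simp
  then have "take r Xs \<in> subset_chains X (r - 1)"
    unfolding subset_chains_def using len sub mono rank_pos by auto
  moreover have "Xs = take r Xs @ [E]"
    using len top take_Suc_conv_app_nth[of r Xs] by simp
  ultimately show "Xs \<in> (\<lambda>Ys. Ys @ [E]) ` subset_chains X (r - 1)" by blast
next
  fix Xs assume "Xs \<in> (\<lambda>Ys. Ys @ [E]) ` subset_chains X (r - 1)"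
  then obtain Ys where Xs: "Xs = Ys @ [E]" and len: "length Ys = r"
    and sub: "\<And>j. j < r \<Longrightarrow> Ys ! j \<subseteq> X" and card: "\<And>j. j < r \<Longrightarrow> card (Ys ! j) = j"
    and mono: "\<And>j. Suc j < r \<Longrightarrow> Ys ! j \<subset> Ys ! Suc j"
    using rank_pos by (auto simp: subset_chains_def)
  have nth: "Xs ! j = Ys ! j" if "j < r" for j using that len Xs by (simp add: nth_append)
  have top: "Xs ! r = E" using len Xs by (metis nth_append_length)
  have psub: "Ys ! j \<subset> X" if "j < r" for j using sub[OF that] card[OF that] card_X that by auto
  have "flat E \<B>' (Xs ! j) \<and> rank_of \<B>' (Xs ! j) = j" if "j \<le> r" for j
  proof (cases "j = r")
    case True
    then show ?thesis using top relax.flat_ground rank_relaxation_ground by simp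
  next
    case False
    then have "j < r" using that by simp
    then show ?thesis
      using flat_relaxation_psubset_X[OF psub] rank_relaxation_subset_X[OF sub] card nth by simp
  qed
  moreover have "Xs ! j \<subset> Xs ! Suc j" if "j < r" for j
  proof (cases "Suc j = r")
    case True
    then show ?thesis using nth[OF that] psub[OF that] X_subset top by auto
  next
    case False
    then show ?thesis using mono[of j] nth[of j] nth[of "Suc j"] that by simp
  qed
  ultimately have "flag E \<B>' Xs" using len Xs top by (simp add: flag_relaxation_iff)
  moreover have "\<not> flag E \<B> Xs"
  proof
    assume "flag E \<B> Xs"
    then have "flat E \<B> (Xs ! (r - 1))" unfolding flag_iff using diff_le_self by blast
    then have flat: "flat E \<B> (Ys ! (r - 1))" using nth[of "r - 1"] rank_pos by simp
    have sub1: "Ys ! (r - 1) \<subseteq> X" and card1: "card (Ys ! (r - 1)) = r - 1"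
      using sub[of "r - 1"] card[of "r - 1"] rank_pos by auto
    then have "card (X - Ys ! (r - 1)) = 1"
      using card_X rank_pos finite_X finite_subset[OF sub1] by (simp add: card_Diff_subset)
    then obtain x where "X - Ys ! (r - 1) = {x}" by (auto simp: card_1_singleton_iff)
    then have "x \<in> X" "Ys ! (r - 1) = X - {x}" using sub1 by auto
    then show False using not_flat_remove flat by simp
  qed
  ultimately show "Xs \<in> {Xs. flag E \<B>' Xs \<and> \<not> flag E \<B> Xs}" by simp
qed

text \<open>Below the hyperplane \<open>X\<close> lie proper subsets of \<open>X\<close> of sizes 0
  to \<open>r - 2\<close>, all flats by \<open>flat_small_subset_X\<close>. In rank 1 the truncated
  \<open>r - 2\<close> would be 0 and the lists on the right would be one entry too long.\<close>

lemma lost_flags: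
  assumes "r \<ge> 2"
  shows "{Xs. flag E \<B> Xs \<and> \<not> flag E \<B>' Xs} = (\<lambda>Ys. Ys @ [X, E]) ` subset_chains X (r - 2)"
proof (intro set_eqI iffI)
  fix Xs assume "Xs \<in> {Xs. flag E \<B> Xs \<and> \<not> flag E \<B>' Xs}"
  then have Xs: "flag E \<B> Xs" and hyp: "Xs ! (r - 1) = X" using lost_flag_hyperplane by auto
  have len: "length Xs = Suc r" and rk: "\<And>j. j \<le> r \<Longrightarrow> rank_of \<B> (Xs ! j) = j"
    and mono: "\<And>j. j < r \<Longrightarrow> Xs ! j \<subset> Xs ! Suc j" and top: "Xs ! r = E"
    using Xs(1) by (auto simp: flag_iff)
  have sub: "Xs ! j \<subset> X" if "j \<le> r - 2" for j
  proof -
    have "Xs ! j \<subseteq> Xs ! (r - 2)" using chain_mono[of r Xs j "r - 2", OF mono] that by auto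
    also have "\<dots> \<subset> Xs ! Suc (r - 2)" using mono assms by simp
    also have "Suc (r - 2) = r - 1" using assms by simp
    finally show ?thesis using hyp by simp
  qed
  then have "card (Xs ! j) = j" if "j \<le> r - 2" for j
    using rank_psubset_X[OF sub[OF that]] rk[of j] that by simp
  then have "take (r - 1) Xs \<in> subset_chains X (r - 2)"
    unfolding subset_chains_def using len sub mono assms by auto
  moreover have "Xs = take (r - 1) Xs @ [X, E]"
  proof -
    have "Xs = take (Suc r) Xs" using len by simp
    also have "\<dots> = take r Xs @ [E]" using len top take_Suc_conv_app_nth[of r Xs] by simp
    also have "take r Xs = take (Suc (r - 1)) Xs" using rank_pos by simp
    also have "\<dots> = take (r - 1) Xs @ [X]" using len hyp by (subst take_Suc_conv_app_nth) auto
    finally show ?thesis by simp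
  qed
  ultimately show "Xs \<in> (\<lambda>Ys. Ys @ [X, E]) ` subset_chains X (r - 2)" by blast
next
  fix Xs assume "Xs \<in> (\<lambda>Ys. Ys @ [X, E]) ` subset_chains X (r - 2)"
  then obtain Ys where Xs: "Xs = Ys @ [X, E]" and len: "length Ys = r - 1"
    and sub: "\<And>j. j < r - 1 \<Longrightarrow> Ys ! j \<subseteq> X" and card: "\<And>j. j < r - 1 \<Longrightarrow> card (Ys ! j) = j"
    and mono: "\<And>j. Suc j < r - 1 \<Longrightarrow> Ys ! j \<subset> Ys ! Suc j"
    using assms by (auto simp: subset_chains_def)
  have nth: "Xs ! j = Ys ! j" if "j < r - 1" for j using that len Xs by (simp add: nth_append)
  have hyp: "Xs ! (r - 1) = X" using len Xs by (metis nth_append_length)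
  have top: "Xs ! r = E" using len Xs assms by (auto simp: nth_append nth_Cons')
  have psub: "Ys ! j \<subset> X" if "j < r - 1" for j using sub[OF that] card[OF that] card_X that by auto
  have "flat E \<B> (Xs ! j) \<and> rank_of \<B> (Xs ! j) = j" if j: "j \<le> r" for j
  proof -
    consider "j = r" | "j = r - 1" | "j < r - 1" using j by linarith
    then show ?thesis
    proof cases
      case 1
      then show ?thesis using top flat_ground by simp
    next
      case 2
      then show ?thesis using hyp flat_X rank_X by simp
    next
      case 3
      then show ?thesis
        using flat_small_subset_X[OF sub] rank_psubset_X[OF psub] card nth by simp
    qed
  qed
  moreover have "Xs ! j \<subset> Xs ! Suc j" if j: "j < r" for j
  proof -
    consider "Suc j = r" | "Suc j = r - 1" | "Suc j < r - 1" using j by linarith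
    then show ?thesis
    proof cases
      case 1
      then have "j = r - 1" by simp
      then show ?thesis using hyp top X_psubset 1 by simp
    next
      case 2
      then show ?thesis using hyp nth[of j] psub[of j] by simp
    next
      case 3
      then show ?thesis using mono[of j] nth[of j] nth[of "Suc j"] by simp
    qed
  qed
  ultimately have "flag E \<B> Xs" using len Xs top assms by (simp add: flag_iff)
  moreover have "\<not> flag E \<B>' Xs"
    using hyp not_flat_relaxation_X by (auto simp: flag_relaxation_iff intro!: exI[of _ "r - 1"])
  ultimately show "Xs \<in> {Xs. flag E \<B> Xs \<and> \<not> flag E \<B>' Xs}" by simp
qed

section \<open>Compositions of the lost and gained flags\<close>

text \<open>The left side is \<open>composition_of Ys\<close> unfolded, with the length of
  \<open>Ys\<close> filled in.\<close>

lemma composition_subset_chain: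
  assumes "Ys \<in> subset_chains X k"
  shows "map (\<lambda>j. if j = 0 then card (Ys ! 0) else card (Ys ! j - Ys ! (j - 1))) [0..<Suc k]
    = 0 # replicate k 1"
proof (rule nth_equalityI)
  fix i assume "i < length (map (\<lambda>j. if j = 0 then card (Ys ! 0) else card (Ys ! j - Ys ! (j - 1)))
    [0..<Suc k])"
  then have i: "i \<le> k" by simp
  show "map (\<lambda>j. if j = 0 then card (Ys ! 0) else card (Ys ! j - Ys ! (j - 1))) [0..<Suc k] ! i
    = (0 # replicate k 1) ! i"
  proof (cases i)
    case 0
    then show ?thesis using assms by (simp add: subset_chains_def del: upt_Suc)
  next
    case (Suc j)
    then have j: "Ys ! j \<subseteq> X" "Ys ! j \<subseteq> Ys ! Suc j" "card (Ys ! j) = j" "card (Ys ! Suc j) = Suc j"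
      using assms i by (simp_all add: subset_chains_def psubset_imp_subset)
    then have "card (Ys ! Suc j - Ys ! j) = 1"
      using finite_X finite_subset by (subst card_Diff_subset) auto
    then show ?thesis using Suc i by (simp del: upt_Suc)
  qed
qed simp

lemma composition_of_snoc:
  assumes "Xs \<noteq> []"
  shows "composition_of (Xs @ [F]) = composition_of Xs @ [card (F - last Xs)]"
  using assms by (auto simp: composition_of_def nth_append last_conv_nth)

lemma composition_gained:
  assumes "Ys \<in> subset_chains X (r - 1)"
  shows "composition_of (Ys @ [E]) = 0 # replicate (r - 1) 1 @ [card E - r + 1]"
proof -
  have len: "length Ys = r" and l: "Ys ! (r - 1) \<subseteq> X" "card (Ys ! (r - 1)) = r - 1"
    using assms rank_pos by (auto simp: subset_chains_def)
  have ne: "Ys \<noteq> []" using len rank_pos by auto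
  have "card (E - Ys ! (r - 1)) = card E - (r - 1)"
    using l X_subset finite_subset[OF l(1) finite_X] by (subst card_Diff_subset) auto
  then have "card (E - last Ys) = card E - r + 1"
    using ne len rank_pos rank_less_card by (simp add: last_conv_nth)
  moreover have "composition_of Ys = 0 # replicate (r - 1) 1"
    using composition_subset_chain[OF assms] len rank_pos
    by (simp add: composition_of_def del: upt_Suc)
  ultimately show ?thesis using composition_of_snoc[OF ne] by simp
qed

text \<open>The entry 2 is the jump from size \<open>r - 2\<close> to the \<open>r\<close> elements
  of \<open>X\<close>.\<close>

lemma composition_lost:
  assumes "r \<ge> 2" "Ys \<in> subset_chains X (r - 2)"
  shows "composition_of (Ys @ [X, E]) = 0 # replicate (r - 2) 1 @ [2, card E - r]"
proof -
  have len: "length Ys = r - 1" and l: "Ys ! (r - 2) \<subseteq> X" "card (Ys ! (r - 2)) = r - 2"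
    using assms by (auto simp: subset_chains_def)
  have ne: "Ys \<noteq> []" using len assms(1) by auto
  have "length Ys - 1 = r - 2" using len by simp
  then have last: "last Ys = Ys ! (r - 2)" using ne by (simp add: last_conv_nth)
  have "card (X - last Ys) = 2"
    unfolding last using l card_X assms(1) finite_subset[OF l(1) finite_X]
    by (subst card_Diff_subset) auto
  moreover have "card (E - X) = card E - r"
    using X_subset finite_X card_X by (simp add: card_Diff_subset)
  moreover have "length Ys = Suc (r - 2)" using len assms(1) by simp
  then have "composition_of Ys = 0 # replicate (r - 2) 1"
    unfolding composition_of_def using composition_subset_chain[OF assms(2)] by simp
  ultimately show ?thesis
    using composition_of_snoc[OF ne, of X] composition_of_snoc[of "Ys @ [X]" E] by simp
qed

text \<open>The last step goes from \<open>X\<close> to \<open>E\<close>. This covers rank 1 too,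
  and it separates lost flags from the composition of the gained ones, whose last entry is larger by
  one.\<close>

lemma composition_lost_last:
  assumes "flag E \<B> Xs" "\<not> flag E \<B>' Xs"
  shows "last (composition_of Xs) = card E - r"
proof -
  have len: "length Xs = Suc r" and top: "Xs ! r = E" using assms(1) by (auto simp: flag_iff)
  then have "last (composition_of Xs) = card (E - X)"
    using lost_flag_hyperplane[OF assms] rank_pos by (simp add: composition_of_def)
  then show ?thesis using X_subset finite_X card_X by (simp add: card_Diff_subset)
qed

section \<open>Comparing the flag counts\<close>

text \<open>Both sides count the flags of composition \<open>a\<close> belonging to at least one of
  the matroids. The additive form avoids truncated subtraction.\<close>

lemma nu_balance:
  "nu E \<B>' a + card {Xs. (flag E \<B> Xs \<and> \<not> flag E \<B>' Xs) \<and> composition_of Xs = a} =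
   nu E \<B> a + card {Xs. (flag E \<B>' Xs \<and> \<not> flag E \<B> Xs) \<and> composition_of Xs = a}"
proof -
  let ?F = "{Xs. flag E \<B> Xs \<and> composition_of Xs = a}"
  let ?F' = "{Xs. flag E \<B>' Xs \<and> composition_of Xs = a}"
  have fin: "finite ?F" "finite ?F'"
    using finite_flags relax.finite_flags by (auto intro: rev_finite_subset)
  have "card ?F' + card (?F - ?F') = card (?F' \<union> (?F - ?F'))"
    using fin by (intro card_Un_disjoint[symmetric]) auto
  also have "?F' \<union> (?F - ?F') = ?F \<union> (?F' - ?F)" by blast
  also have "card \<dots> = card ?F + card (?F' - ?F)"
    using fin by (intro card_Un_disjoint) auto
  also have "?F - ?F' = {Xs. (flag E \<B> Xs \<and> \<not> flag E \<B>' Xs) \<and> composition_of Xs = a}" by blast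
  also have "?F' - ?F = {Xs. (flag E \<B>' Xs \<and> \<not> flag E \<B> Xs) \<and> composition_of Xs = a}" by blast
  finally show ?thesis by (simp add: nu_def)
qed

lemma card_gained:
  "card {Xs. (flag E \<B>' Xs \<and> \<not> flag E \<B> Xs) \<and> composition_of Xs = a} =
    (if a = 0 # replicate (r - 1) 1 @ [card E - r + 1] then fact r else 0)"
proof -
  let ?G = "{Xs. flag E \<B>' Xs \<and> \<not> flag E \<B> Xs}"
  have "composition_of Xs = 0 # replicate (r - 1) 1 @ [card E - r + 1]" if "Xs \<in> ?G" for Xs
    using that composition_gained unfolding gained_flags by blast
  then have "{Xs. (flag E \<B>' Xs \<and> \<not> flag E \<B> Xs) \<and> composition_of Xs = a} =
    (if a = 0 # replicate (r - 1) 1 @ [card E - r + 1] then ?G else {})"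
    by auto
  \<comment> \<open>The lower limit is \<open>card X - (r - 1) + 1 = 2\<close>.\<close>
  moreover have "card ?G = \<Prod>{2..r}"
    unfolding gained_flags using card_subset_chains[OF finite_X, of "r - 1"] card_X rank_pos
    by (simp add: card_image inj_on_def numeral_2_eq_2)
  moreover have "\<Prod>{2..r} = fact r"
    using rank_pos prod.atLeast_Suc_atMost[of 1 r "\<lambda>i. i"] by (simp add: fact_prod numeral_2_eq_2)
  ultimately show ?thesis by simp
qed

text \<open>The lost flags number \<open>r (r - 1) ... 3\<close>, half of \<open>fact r\<close>;
  doubling keeps the equation in the natural numbers.\<close>

lemma card_lost:
  assumes "r \<ge> 2"
  shows "2 * card {Xs. (flag E \<B> Xs \<and> \<not> flag E \<B>' Xs) \<and> composition_of Xs = a} =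
    (if a = 0 # replicate (r - 2) 1 @ [2, card E - r] then fact r else 0)"
proof -
  let ?G = "{Xs. flag E \<B> Xs \<and> \<not> flag E \<B>' Xs}"
  have "composition_of Xs = 0 # replicate (r - 2) 1 @ [2, card E - r]" if "Xs \<in> ?G" for Xs
    using that composition_lost[OF assms] unfolding lost_flags[OF assms] by blast
  then have "{Xs. (flag E \<B> Xs \<and> \<not> flag E \<B>' Xs) \<and> composition_of Xs = a} =
    (if a = 0 # replicate (r - 2) 1 @ [2, card E - r] then ?G else {})"
    by auto
  moreover have "card ?G = \<Prod>{3..r}"
    unfolding lost_flags[OF assms]
    using card_subset_chains[OF finite_X, of "r - 2"] card_X assms
    by (simp add: card_image inj_on_def numeral_3_eq_3)
  moreover have "2 * \<Prod>{3..r} = fact r"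
    using assms prod.atLeast_Suc_atMost[of 1 r "\<lambda>i. i"] prod.atLeast_Suc_atMost[of 2 r "\<lambda>i. i"]
    by (simp add: fact_prod numeral_2_eq_2 numeral_3_eq_3)
  ultimately show ?thesis by simp
qed

lemma nu_relaxation_gained_composition:
  "nu E \<B>' (0 # replicate (r - 1) 1 @ [card E - r + 1]) =
   nu E \<B> (0 # replicate (r - 1) 1 @ [card E - r + 1]) + fact r" (is "nu _ _ ?a = _")
proof -
  have "{Xs. (flag E \<B> Xs \<and> \<not> flag E \<B>' Xs) \<and> composition_of Xs = ?a} = {}"
    using composition_lost_last by force
  then show ?thesis using nu_balance[of ?a] card_gained[of ?a] by (metis add_0_right card.empty)
qed

text \<open>One identity for all \<open>a\<close>: it yields both the value at the composition of
  the lost flags and the list of compositions where the counts differ.\<close>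

lemma nu_relaxation:
  assumes "r \<ge> 2"
  shows "2 * nu E \<B>' a + (if a = 0 # replicate (r - 2) 1 @ [2, card E - r] then fact r else 0) =
    2 * nu E \<B> a + (if a = 0 # replicate (r - 1) 1 @ [card E - r + 1] then 2 * fact r else 0)"
  using nu_balance[of a] card_gained[of a] card_lost[OF assms, of a] by auto

end

text \<open>In rank 1 the second displayed list would have length 3 rather than
  \<open>r + 1 = 2\<close>, and the lost flag \<open>[X, E]\<close> has composition
  \<open>[1, n - 1]\<close>; hence the guard \<open>r \<ge> 2\<close>.\<close>

theorem proposition4p16:
  fixes E :: "'a set" and \<B> \<B>' :: "'a set set" and X :: "'a set" and n r :: nat
  assumes "matroid E \<B>"
    and "card E = n"
    and "rank_of \<B> E = r"
    and "circuit_hyperplane E \<B> X"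
    and "\<B>' = relaxation \<B> X"
  shows "(G_invariant E \<B>' - G_invariant E \<B> :: nat list \<Rightarrow>\<^sub>0 'k::field_char_0) =
           scale (fact r * fact (n - r))
             (symb (replicate r 1 @ replicate (n - r) 0)
              - symb (replicate (r - 1) 1 @ [0, 1] @ replicate (n - r - 1) 0))
       \<and> nu E \<B>' (0 # replicate (r - 1) 1 @ [n - r + 1]) =
           nu E \<B> (0 # replicate (r - 1) 1 @ [n - r + 1]) + fact r
       \<and> (r \<ge> 2 \<longrightarrow>
           real (nu E \<B>' (0 # replicate (r - 2) 1 @ [2, n - r])) =
             real (nu E \<B> (0 # replicate (r - 2) 1 @ [2, n - r])) - fact r / 2
         \<and> {a. is_composition n r a \<and> nu E \<B>' a \<noteq> nu E \<B> a} =
             {0 # replicate (r - 1) 1 @ [n - r + 1], 0 # replicate (r - 2) 1 @ [2, n - r]})"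
proof -
  interpret CH: circuit_hyperplane_matroid E \<B> X
    using assms by (simp add: circuit_hyperplane_matroid_def circuit_hyperplane_matroid_axioms_def)
  let ?a = "0 # replicate (r - 1) 1 @ [n - r + 1]" and ?b = "0 # replicate (r - 2) 1 @ [2, n - r]"
  note eqs = assms(2,3) assms(5)[symmetric]
  have rn: "r > 0" "r < n" using CH.rank_pos CH.rank_less_card unfolding eqs by simp_all
  have "real (nu E \<B>' ?b) = real (nu E \<B> ?b) - fact r / 2
      \<and> {a. is_composition n r a \<and> nu E \<B>' a \<noteq> nu E \<B> a} = {?a, ?b}" if r: "r \<ge> 2"
  proof -
    have ab: "?a \<noteq> ?b"
    proof
      assume "?a = ?b"
      then have "last ?a = last ?b" by (rule arg_cong)
      then show False by simp
    qed
    have nu: "2 * nu E \<B>' a + (if a = ?b then fact r else 0)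
        = 2 * nu E \<B> a + (if a = ?a then 2 * fact r else 0)" for a
      using CH.nu_relaxation[of a] r unfolding eqs by simp
    have "2 * nu E \<B>' ?b + fact r = 2 * nu E \<B> ?b" using nu[of ?b] ab by simp
    then have "real (2 * nu E \<B>' ?b + fact r) = real (2 * nu E \<B> ?b)" by (rule arg_cong)
    then have half: "real (nu E \<B>' ?b) = real (nu E \<B> ?b) - fact r / 2" by simp
    \<comment> \<open>Since \<open>?a\<close> and \<open>?b\<close> are distinct, at most one
      correction term is present, and factorials are nonzero, so nothing cancels.\<close>
    have iff: "nu E \<B>' a \<noteq> nu E \<B> a \<longleftrightarrow> a = ?a \<or> a = ?b" for a
      using nu[of a] ab fact_nonzero[of r, where 'a = nat] by (auto split: if_splits)
    \<comment> \<open>Positivity of the last entry of \<open>?b\<close> comes from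
      \<open>r < n\<close>.\<close>
    have "is_composition n r ?a" "is_composition n r ?b"
      using r rn by (auto simp: is_composition_def sum_list_replicate nth_Cons nth_append split: nat.splits)
    then show ?thesis using half iff by blast
  qed
  then show ?thesis
    using CH.G_invariant_relaxation[where 'k = 'k] CH.nu_relaxation_gained_composition unfolding eqs by blast
qed

end
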